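(* Let $\mathcal{N}=\{1,\dots,n\}$ be a fixed assortment, let $\mathcal{M}_1$ be the Ising model with symmetric parameter matrix $\theta\in\mathbb{S}^n$ defined over binary variables, and let $\mathcal{M}_2$ be the Ising model with symmetric parameter matrix $\tilde\theta\in\mathbb{S}^n$ defined over spin variables. If $$\theta_{ii}=2\tilde\theta_{ii}-4\sum_{j\in\mathcal{N}:\,j\ne i}\tilde\theta_{ij}\quad\forall i\in\mathcal{N},\qquad \theta_{ij}=4\tilde\theta_{ij}\quad\forall i,j\in\mathcal{N}:\ i\ne j,$$ then the probabilities of customers selecting baskets from $\mathcal{N}$ yielded by $\mathcal{M}_1$ and $\mathcal{M}_2$ are identical.
   Context: A basket from $\mathcal{N}$ is a subset of $\mathcal{N}$. In the binary model a basket $b$ is represented by $x\in\{0,1\}^n$ with $x_i=1$ iff $i\in b$, and its probability is proportional (over $x\in\{0,1\}^n$) to $\exp\bigl(\sum_{i\in\mathcal{N}}\theta_{ii}x_i+\sum_{i\ne j,\ i,j\in\mathcal{N}}x_i\theta_{ij}x_j\bigr)$. In the spin model $b$ is represented by $\tilde x\in\{-1,1\}^n$ with $\tilde x_i=1$ if $i\in b$ and $\tilde x_i=-1$ otherwise, and its probability is proportional (over $\tilde x\in\{-1,1\}^n$) to $\exp\bigl(\sum_{i\in\mathcal{N}}\tilde\theta_{ii}\tilde x_i+\sum_{i\ne j,\ i,j\in\mathcal{N}}\tilde x_i\tilde\theta_{ij}\tilde x_j\bigr)$. Sums over $i\ne j$ run over ordered pairs (each unordered pair is counted twice). *)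

theory Defs
  imports "HOL-Analysis.Analysis"
begin

text \<open>
  The assortment is the finite index type \<open>'n\<close>, so \<open>n = CARD('n)\<close>; a basket is a set
  \<open>b :: 'n set\<close>, and a parameter matrix has type \<open>real ^ 'n ^ 'n\<close>.
\<close>

definition binary_vectors :: "(real ^ 'n::finite) set" where
  "binary_vectors = {x. \<forall>i. x $ i \<in> {0, 1}}"

definition spin_vectors :: "(real ^ 'n::finite) set" where
  "spin_vectors = {x. \<forall>i. x $ i \<in> {-1, 1}}"

definition binary_rep :: "'n::finite set \<Rightarrow> real ^ 'n" where
  "binary_rep b = (\<chi> i. if i \<in> b then 1 else 0)"

definition spin_rep :: "'n::finite set \<Rightarrow> real ^ 'n" where
  "spin_rep b = (\<chi> i. if i \<in> b then 1 else -1)"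

text \<open>The second sum ranges over ordered pairs, so each unordered pair is counted twice.\<close>

definition ising_exponent :: "real ^ 'n ^ 'n \<Rightarrow> real ^ 'n::finite \<Rightarrow> real" where
  "ising_exponent \<theta> x =
     (\<Sum>i\<in>UNIV. \<theta> $ i $ i * x $ i) +
     (\<Sum>(i, j)\<in>{(i, j). i \<noteq> j}. x $ i * \<theta> $ i $ j * x $ j)"

definition ising_prob :: "(real ^ 'n) set \<Rightarrow> real ^ 'n ^ 'n \<Rightarrow> real ^ 'n::finite \<Rightarrow> real" where
  "ising_prob X \<theta> x = exp (ising_exponent \<theta> x) / (\<Sum>y\<in>X. exp (ising_exponent \<theta> y))"

definition binary_basket_prob :: "real ^ 'n ^ 'n \<Rightarrow> 'n::finite set \<Rightarrow> real" where
  "binary_basket_prob \<theta> b = ising_prob binary_vectors \<theta> (binary_rep b)"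

definition spin_basket_prob :: "real ^ 'n ^ 'n \<Rightarrow> 'n::finite set \<Rightarrow> real" where
  "spin_basket_prob \<theta> b = ising_prob spin_vectors \<theta> (spin_rep b)"

text \<open>
  The representations are bijections between baskets and the two finite state spaces, hence the
  normalising sums are genuine (nonzero) and both models are probability distributions on baskets.
\<close>

lemma bij_betw_binary_rep: "bij_betw binary_rep UNIV binary_vectors"
  by (rule bij_betw_byWitness[where f' = "\<lambda>x. {i. x $ i = 1}"])
     (auto simp: binary_rep_def binary_vectors_def vec_eq_iff)

lemma bij_betw_spin_rep: "bij_betw spin_rep UNIV spin_vectors"
  by (rule bij_betw_byWitness[where f' = "\<lambda>x. {i. x $ i = 1}"])
     (auto simp: spin_rep_def spin_vectors_def vec_eq_iff, metis)

lemma finite_binary_vectors: "finite binary_vectors"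
  using bij_betw_finite[OF bij_betw_binary_rep] by simp

lemma finite_spin_vectors: "finite spin_vectors"
  using bij_betw_finite[OF bij_betw_spin_rep] by simp

lemma sum_ising_prob:
  assumes "finite X" "X \<noteq> {}"
  shows "(\<Sum>x\<in>X. ising_prob X \<theta> x) = 1"
proof -
  have "(\<Sum>y\<in>X. exp (ising_exponent \<theta> y)) > 0"
    using assms by (intro sum_pos) auto
  then show ?thesis
    by (simp add: ising_prob_def flip: sum_divide_distrib)
qed

lemma sum_binary_basket_prob: "(\<Sum>b\<in>UNIV. binary_basket_prob \<theta> b) = 1"
proof -
  have "binary_vectors \<noteq> {}" using bij_betw_binary_rep by (auto simp: bij_betw_def)
  then show ?thesis
    unfolding binary_basket_prob_def sum.reindex_bij_betw[OF bij_betw_binary_rep]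
    by (rule sum_ising_prob[OF finite_binary_vectors])
qed

lemma sum_spin_basket_prob: "(\<Sum>b\<in>UNIV. spin_basket_prob \<theta> b) = 1"
proof -
  have "spin_vectors \<noteq> {}" using bij_betw_spin_rep by (auto simp: bij_betw_def)
  then show ?thesis
    unfolding spin_basket_prob_def sum.reindex_bij_betw[OF bij_betw_spin_rep]
    by (rule sum_ising_prob[OF finite_spin_vectors])
qed

end

theory Submission
  imports Defs
begin

text \<open>
  The two representations of a basket are related by the affine map \<open>y = 2 x - 1\<close>. Substituting it
  into the spin exponent and expanding,
  \<open>(2 x\<^sub>i - 1) \<theta>'\<^sub>i\<^sub>j (2 x\<^sub>j - 1) = 4 x\<^sub>i \<theta>'\<^sub>i\<^sub>j x\<^sub>j - 2 \<theta>'\<^sub>i\<^sub>j x\<^sub>i - 2 \<theta>'\<^sub>i\<^sub>j x\<^sub>j + \<theta>'\<^sub>i\<^sub>j\<close>,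
  so the quadratic coefficients become \<open>4 \<theta>'\<^sub>i\<^sub>j\<close>. By symmetry of \<open>\<theta>'\<close>, the two linear terms
  contribute the same amount when summed over ordered pairs; together with \<open>2 \<theta>'\<^sub>i\<^sub>i x\<^sub>i\<close>
  they give exactly the prescribed diagonal of \<open>\<theta>\<close>. What remains is independent of \<open>x\<close>
  (lemma \<open>ising_exponent_spin_substitution\<close>). Thus the unnormalised weights of the two models
  differ by one positive factor common to all baskets, and normalisation cancels it
  (lemma \<open>ising_prob_eq_if_exponents_differ_by_constant\<close>).
\<close>

lemma sum_off_diagonal:
  fixes f :: "'n::finite \<Rightarrow> 'n \<Rightarrow> 'a::comm_monoid_add"
  shows "(\<Sum>(i, j)\<in>{(i, j). i \<noteq> j}. f i j) = (\<Sum>i\<in>UNIV. \<Sum>j\<in>{j. j \<noteq> i}. f i j)"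
proof -
  have "{(i::'n, j). i \<noteq> j} = Sigma UNIV (\<lambda>i. {j. j \<noteq> i})"
    by auto
  then show ?thesis
    by (simp add: sum.Sigma)
qed

lemma sum_off_diagonal_swap:
  fixes f :: "'n::finite \<Rightarrow> 'n \<Rightarrow> 'a::comm_monoid_add"
  shows "(\<Sum>(i, j)\<in>{(i, j). i \<noteq> j}. f i j) = (\<Sum>(i, j)\<in>{(i, j). i \<noteq> j}. f j i)"
  by (rule sum.reindex_bij_witness[of _ prod.swap prod.swap]) auto

text \<open>
  Both sides are quadratic polynomials in a real vector \<open>x\<close> whose coefficients agree degree by
  degree. At \<open>x = 0\<close> the exponent for \<open>\<theta>\<close> vanishes, which identifies the constant term as the
  spin exponent of the empty basket.
\<close>

lemma ising_exponent_spin_substitution: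
  fixes \<theta> \<theta>' :: "real ^ 'n ^ 'n::finite"
  assumes sym: "transpose \<theta>' = \<theta>'"
    and diag: "\<And>i. \<theta> $ i $ i = 2 * \<theta>' $ i $ i - 4 * (\<Sum>j\<in>{j. j \<noteq> i}. \<theta>' $ i $ j)"
    and off: "\<And>i j. i \<noteq> j \<Longrightarrow> \<theta> $ i $ j = 4 * \<theta>' $ i $ j"
  shows "ising_exponent \<theta>' (\<chi> i. 2 * x $ i - 1)
       = ising_exponent \<theta> x + ising_exponent \<theta>' (spin_rep {})"
proof -
  let ?P = "{(i::'n, j). i \<noteq> j}"
  define L where "L = (\<Sum>(i, j)\<in>?P. \<theta>' $ i $ j * x $ i)"
  define Q where "Q = (\<Sum>(i, j)\<in>?P. x $ i * \<theta>' $ i $ j * x $ j)"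
  define K where "K = (\<Sum>(i, j)\<in>?P. \<theta>' $ i $ j)"
  define D where "D = (\<Sum>i\<in>UNIV. \<theta>' $ i $ i * x $ i)"
  define T where "T = (\<Sum>i\<in>UNIV. \<theta>' $ i $ i)"
  have "\<theta>' $ i $ j = \<theta>' $ j $ i" for i j
    using sym by (metis transpose_def vec_lambda_beta)
  then have L': "(\<Sum>(i, j)\<in>?P. \<theta>' $ i $ j * x $ j) = L"
    unfolding L_def by (subst sum_off_diagonal_swap) simp
  have "(\<Sum>(i, j)\<in>?P. (2 * x $ i - 1) * \<theta>' $ i $ j * (2 * x $ j - 1))
      = (\<Sum>(i, j)\<in>?P. 4 * (x $ i * \<theta>' $ i $ j * x $ j) - 2 * (\<theta>' $ i $ j * x $ i)
          - 2 * (\<theta>' $ i $ j * x $ j) + \<theta>' $ i $ j)"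
    by (intro sum.cong) (auto simp: algebra_simps)
  \<comment> \<open>The second \<open>L\<close> is the linear term in \<open>x\<^sub>j\<close>, folded into the first by symmetry.\<close>
  also have "\<dots> = 4 * Q - 2 * L - 2 * L + K"
    unfolding Q_def K_def
    by (subst (2) L'[symmetric])
       (simp add: L_def case_prod_unfold sum.distrib sum_subtractf sum_distrib_left)
  finally have pairs: "(\<Sum>(i, j)\<in>?P. (2 * x $ i - 1) * \<theta>' $ i $ j * (2 * x $ j - 1))
      = 4 * Q - 4 * L + K"
    by simp
  have singles: "(\<Sum>i\<in>UNIV. \<theta>' $ i $ i * (2 * x $ i - 1)) = 2 * D - T"
    by (simp add: D_def T_def algebra_simps sum_subtractf sum_distrib_left)
  have binary_pairs: "(\<Sum>(i, j)\<in>?P. x $ i * \<theta> $ i $ j * x $ j) = 4 * Q"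
    unfolding Q_def sum_distrib_left by (intro sum.cong) (auto simp: off)
  have "(\<Sum>i\<in>UNIV. \<theta> $ i $ i * x $ i)
      = (\<Sum>i\<in>UNIV. 2 * (\<theta>' $ i $ i * x $ i) - 4 * (\<Sum>j\<in>{j. j \<noteq> i}. \<theta>' $ i $ j * x $ i))"
    by (simp add: diag left_diff_distrib sum_distrib_right mult.assoc)
  also have "\<dots> = 2 * D - 4 * L"
    by (simp add: D_def L_def sum_off_diagonal sum_subtractf flip: sum_distrib_left)
  finally have binary_singles: "(\<Sum>i\<in>UNIV. \<theta> $ i $ i * x $ i) = 2 * D - 4 * L" .
  have "ising_exponent \<theta>' (spin_rep {}) = K - T"
    by (simp add: ising_exponent_def spin_rep_def K_def T_def sum_negf)
  then show ?thesis
    using pairs singles binary_pairs binary_singles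
    by (simp add: ising_exponent_def)
qed

text \<open>
  Reindexing both normalising sums by a common set \<open>A\<close> (here, the baskets) makes models on
  different state spaces comparable; the factor \<open>exp c\<close> then cancels from the quotient.
\<close>

lemma ising_prob_eq_if_exponents_differ_by_constant:
  fixes \<theta> \<theta>' :: "real ^ 'n ^ 'n::finite"
  assumes "bij_betw f A X" and "bij_betw g A Y"
    and shift: "\<And>a. a \<in> A \<Longrightarrow> ising_exponent \<theta>' (g a) = ising_exponent \<theta> (f a) + c"
    and "b \<in> A"
  shows "ising_prob X \<theta> (f b) = ising_prob Y \<theta>' (g b)"
proof -
  have "(\<Sum>y\<in>Y. exp (ising_exponent \<theta>' y)) = (\<Sum>a\<in>A. exp (ising_exponent \<theta>' (g a)))"
    using assms(2) by (rule sum.reindex_bij_betw[symmetric])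
  also have "\<dots> = (\<Sum>a\<in>A. exp (ising_exponent \<theta> (f a)) * exp c)"
    by (intro sum.cong) (simp_all add: shift exp_add)
  also have "\<dots> = (\<Sum>x\<in>X. exp (ising_exponent \<theta> x) * exp c)"
    using assms(1) by (rule sum.reindex_bij_betw)
  finally have "(\<Sum>y\<in>Y. exp (ising_exponent \<theta>' y)) = (\<Sum>x\<in>X. exp (ising_exponent \<theta> x)) * exp c"
    by (simp add: sum_distrib_right)
  then show ?thesis
    using \<open>b \<in> A\<close> by (simp add: ising_prob_def shift exp_add)
qed

theorem proposition1:
  fixes \<theta> \<theta>' :: "real ^ 'n ^ 'n::finite"
  assumes "transpose \<theta> = \<theta>"
    and "transpose \<theta>' = \<theta>'"
    and "\<forall>i. \<theta> $ i $ i = 2 * \<theta>' $ i $ i - 4 * (\<Sum>j\<in>{j. j \<noteq> i}. \<theta>' $ i $ j)"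
    and "\<forall>i j. i \<noteq> j \<longrightarrow> \<theta> $ i $ j = 4 * \<theta>' $ i $ j"
  shows "\<forall>b :: 'n set. binary_basket_prob \<theta> b = spin_basket_prob \<theta>' b"
proof
  fix b :: "'n set"
  have "spin_rep a = (\<chi> i. 2 * binary_rep a $ i - 1)" for a :: "'n set"
    by (simp add: spin_rep_def binary_rep_def vec_eq_iff)
  then have "ising_exponent \<theta>' (spin_rep a)
      = ising_exponent \<theta> (binary_rep a) + ising_exponent \<theta>' (spin_rep {})" for a
    using ising_exponent_spin_substitution[of \<theta>' \<theta> "binary_rep a"] assms by metis
  then show "binary_basket_prob \<theta> b = spin_basket_prob \<theta>' b"
    unfolding binary_basket_prob_def spin_basket_prob_def
    using ising_prob_eq_if_exponents_differ_by_constant[OF bij_betw_binary_rep bij_betw_spin_rep]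
    by blast
qed

end
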